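(* Let $\varphi(z)=1+B_1z+B_2z^2+B_3z^3+\cdots$ be a Ma–Minda function on $\mathbb{D}$ (so in particular $B_1>0$ and all $B_i$ are real), and let $f\in\mathcal{C}(\varphi)$ have logarithmic coefficients $\gamma_1,\gamma_2,\gamma_3,\dots$. Put $\mu_2=(B_1^2+4B_2)/(2B_1)$ and $\nu_2=(B_1B_2+2B_3)/(2B_1)$. If $\left|B_2+\frac14B_1^2\right|\ge B_1$ and $(\mu_2,\nu_2)\in D_1\cup D_2\cup D_3$, then $$|\gamma_2^2-\gamma_3^2|\le\frac{B_1^4+8B_1^2B_2+16B_2^2+B_1^2B_2^2+4B_1B_2B_3+4B_3^2}{2304}.$$ The bound is sharp: for every such $\varphi$ satisfying these conditions there is a function in $\mathcal{C}(\varphi)$ for which equality holds.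
   Context: $\mathbb{D}=\{z\in\mathbb{C}:|z|<1\}$. $\mathcal{S}$ is the class of univalent analytic functions $f$ on $\mathbb{D}$ of the form $f(z)=z+\sum_{n\ge2}a_nz^n$. The logarithmic coefficients $\gamma_n=\gamma_n(f)$ of $f\in\mathcal{S}$ are defined by $\log\frac{f(z)}{z}=2\sum_{n=1}^\infty\gamma_nz^n$, $z\in\mathbb{D}$, where $\log 1=0$. A Schwarz function is an analytic $\omega:\mathbb{D}\to\mathbb{D}$ with $\omega(0)=0$. For analytic $g,h$ on $\mathbb{D}$, $g\prec h$ ($g$ is subordinate to $h$) means $g=h\circ\omega$ for some Schwarz function $\omega$. A Ma–Minda function is an analytic univalent function $\varphi$ on $\mathbb{D}$ with positive real part such that $\varphi(0)=1$, $\varphi'(0)>0$, and $\varphi(\mathbb{D})$ is symmetric with respect to the real axis and starlike with respect to $\varphi(0)=1$. Its Taylor expansion is written $\varphi(z)=1+B_1z+B_2z^2+B_3z^3+\cdots$, $B_1>0$. $\mathcal{C}(\varphi)=\{f\in\mathcal{S}: 1+zf''(z)/f'(z)\prec\varphi(z)\}$. The subsets $D_1,D_2,D_3$ of $\mathbb{R}^2$ are $D_1=\{(\mu,\nu):|\mu|\le2,\ \nu\ge1\}$, $D_2=\{(\mu,\nu):2\le|\mu|\le4,\ \nu\ge\frac1{12}(\mu^2+8)\}$, $D_3=\{(\mu,\nu):|\mu|\ge4,\ \nu\ge\frac23(|\mu|-1)\}$. *)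

theory Defs
  imports "HOL-Complex_Analysis.Complex_Analysis"
begin

abbreviation unit_disc :: "complex set" (\<open>\<D>\<close>)
  where "\<D> \<equiv> ball 0 1"

definition class_S :: "(complex \<Rightarrow> complex) set"
  where "class_S = {f. f holomorphic_on \<D> \<and> inj_on f \<D> \<and> f 0 = 0 \<and> deriv f 0 = 1}"

text \<open>
  \<open>L\<close> is the branch of \<open>log (f z / z)\<close> on the disc that vanishes at \<open>0\<close>, where the singularity
  is removable with value \<open>1\<close>. Only \<open>\<gamma> n\<close> with \<open>n \<ge> 1\<close> matters; \<open>\<gamma> 0\<close> is unconstrained.
\<close>
definition log_coeffs :: "(complex \<Rightarrow> complex) \<Rightarrow> (nat \<Rightarrow> complex) \<Rightarrow> bool"
  where "log_coeffs f \<gamma> \<longleftrightarrow>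
    (\<exists>L. L holomorphic_on \<D> \<and> L 0 = 0 \<and> (\<forall>z\<in>\<D> - {0}. exp (L z) = f z / z) \<and>
         (\<forall>z\<in>\<D>. (\<lambda>n. 2 * (\<gamma> (Suc n) * z ^ Suc n)) sums L z))"

definition schwarz_function :: "(complex \<Rightarrow> complex) \<Rightarrow> bool"
  where "schwarz_function \<omega> \<longleftrightarrow> \<omega> holomorphic_on \<D> \<and> \<omega> ` \<D> \<subseteq> \<D> \<and> \<omega> 0 = 0"

definition subordinate :: "(complex \<Rightarrow> complex) \<Rightarrow> (complex \<Rightarrow> complex) \<Rightarrow> bool"  (infix \<open>\<prec>\<close> 50)
  where "g \<prec> h \<longleftrightarrow> (\<exists>\<omega>. schwarz_function \<omega> \<and> (\<forall>z\<in>\<D>. g z = h (\<omega> z)))"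

definition ma_minda :: "(complex \<Rightarrow> complex) \<Rightarrow> bool"
  where "ma_minda \<phi> \<longleftrightarrow>
    \<phi> holomorphic_on \<D> \<and> inj_on \<phi> \<D> \<and> (\<forall>z\<in>\<D>. 0 < Re (\<phi> z)) \<and>
    \<phi> 0 = 1 \<and> deriv \<phi> 0 \<in> \<real> \<and> 0 < Re (deriv \<phi> 0) \<and>
    cnj ` (\<phi> ` \<D>) = \<phi> ` \<D> \<and>
    (\<forall>w\<in>\<phi> ` \<D>. closed_segment 1 w \<subseteq> \<phi> ` \<D>)"

definition class_C :: "(complex \<Rightarrow> complex) \<Rightarrow> (complex \<Rightarrow> complex) set"
  where "class_C \<phi> = {f \<in> class_S. (\<lambda>z. 1 + z * deriv (deriv f) z / deriv f z) \<prec> \<phi>}"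

definition D1 :: "(real \<times> real) set"
  where "D1 = {(\<mu>, \<nu>). \<bar>\<mu>\<bar> \<le> 2 \<and> 1 \<le> \<nu>}"

definition D2 :: "(real \<times> real) set"
  where "D2 = {(\<mu>, \<nu>). 2 \<le> \<bar>\<mu>\<bar> \<and> \<bar>\<mu>\<bar> \<le> 4 \<and> 1 / 12 * (\<mu>\<^sup>2 + 8) \<le> \<nu>}"

definition D3 :: "(real \<times> real) set"
  where "D3 = {(\<mu>, \<nu>). 4 \<le> \<bar>\<mu>\<bar> \<and> 2 / 3 * (\<bar>\<mu>\<bar> - 1) \<le> \<nu>}"

text \<open>Logarithmic coefficients of a function in \<open>class_S\<close> exist and are unique.\<close>

lemma log_coeffs_exist:
  assumes "f \<in> class_S"
  shows "\<exists>\<gamma>. log_coeffs f \<gamma>"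
proof -
  from assms have f: "f holomorphic_on \<D>" "inj_on f \<D>" "f 0 = 0" "deriv f 0 = 1"
    by (auto simp: class_S_def)
  define g where "g z = (if z = 0 then deriv f 0 else (f z - f 0) / (z - 0))" for z
  have g: "g holomorphic_on \<D>"
    unfolding g_def by (rule pole_lemma) (use f in auto)
  have nz: "g z \<noteq> 0" if "z \<in> \<D>" for z
  proof (cases "z = 0")
    case False
    with that f have "f z \<noteq> f 0"
      by (metis centre_in_ball inj_on_def zero_less_one)
    with False show ?thesis by (simp add: g_def)
  qed (simp add: g_def f)
  obtain K where K: "K holomorphic_on \<D>" "\<And>z. z \<in> \<D> \<Longrightarrow> g z = exp (K z)"
    using contractible_imp_holomorphic_log[OF g _ nz] convex_imp_contractible convex_ball by metis
  define L where "L z = K z - K 0" for z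
  have K0: "exp (K 0) = 1"
    using K(2)[of 0] by (simp add: g_def f)
  have L: "L holomorphic_on \<D>"
    unfolding L_def by (intro holomorphic_intros K)
  define \<gamma> where "\<gamma> n = (deriv ^^ n) L 0 / fact n / 2" for n
  have "(\<lambda>n. 2 * (\<gamma> (Suc n) * z ^ Suc n)) sums L z" if "z \<in> \<D>" for z
  proof -
    have "(\<lambda>n. 2 * (\<gamma> n * z ^ n)) sums L z"
      using holomorphic_power_series[OF L that] by (simp add: \<gamma>_def)
    moreover have "2 * (\<gamma> 0 * z ^ 0) = 0"
      by (simp add: \<gamma>_def L_def)
    ultimately show ?thesis
      by (subst sums_Suc_iff) (simp only: add_0_right)
  qed
  moreover have "exp (L z) = f z / z" if "z \<in> \<D> - {0}" for z
    using that K(2)[of z] K0 f(3) by (auto simp: L_def g_def exp_diff)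
  ultimately show ?thesis
    using L unfolding log_coeffs_def by (intro exI[of _ \<gamma>] exI[of _ L]) (auto simp: L_def)
qed

lemma log_coeffs_unique:
  assumes "log_coeffs f \<gamma>" "log_coeffs f \<delta>" "n \<ge> 1"
  shows "\<gamma> n = \<delta> n"
proof -
  obtain L where L: "L holomorphic_on \<D>" "L 0 = 0" "\<And>z. z \<in> \<D> - {0} \<Longrightarrow> exp (L z) = f z / z"
      "\<And>z. z \<in> \<D> \<Longrightarrow> (\<lambda>n. 2 * (\<gamma> (Suc n) * z ^ Suc n)) sums L z"
    using assms(1) unfolding log_coeffs_def by metis
  obtain M where M: "M holomorphic_on \<D>" "M 0 = 0" "\<And>z. z \<in> \<D> - {0} \<Longrightarrow> exp (M z) = f z / z"
      "\<And>z. z \<in> \<D> \<Longrightarrow> (\<lambda>n. 2 * (\<delta> (Suc n) * z ^ Suc n)) sums M z"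
    using assms(2) unfolding log_coeffs_def by metis
  have e: "exp (L z - M z) = 1" if "z \<in> \<D>" for z
  proof (cases "z = 0")
    case False
    with that have "exp (L z) = exp (M z)" using L(3) M(3) by simp
    then show ?thesis by (simp add: exp_diff)
  qed (simp add: L M)
  have "((\<lambda>z. L z - M z) has_field_derivative 0) (at z)" if z: "z \<in> \<D>" for z
  proof -
    obtain d where d: "((\<lambda>z. L z - M z) has_field_derivative d) (at z)"
      using holomorphic_on_diff[OF L(1) M(1)] z
      by (metis field_differentiable_def holomorphic_on_imp_differentiable_at open_ball)
    have "((\<lambda>z. exp (L z - M z)) has_field_derivative exp (L z - M z) * d) (at z)"
      using DERIV_fun_exp[OF d] .
    moreover have "((\<lambda>z. exp (L z - M z)) has_field_derivative 0) (at z)"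
      by (rule has_field_derivative_transform_within_open[where f = "\<lambda>_. 1" and S = "\<D>"])
         (use z e in \<open>auto simp: e\<close>)
    ultimately have "exp (L z - M z) * d = 0" by (rule DERIV_unique)
    with d show ?thesis by simp
  qed
  then have "\<exists>c. \<forall>z\<in>\<D>. L z - M z = c"
    by (intro has_field_derivative_zero_constant)
       (auto intro: has_field_derivative_at_within)
  then have LM: "L z = M z" if "z \<in> \<D>" for z
    using that L(2) M(2) by (metis centre_in_ball diff_self eq_iff_diff_eq_0 zero_less_one)
  define a where "a n = (if n = 0 then 0 else 2 * (\<gamma> n - \<delta> n))" for n
  have "(\<lambda>n. a n * z ^ n) sums 0" if "norm z < 1" for z
  proof -
    have z: "z \<in> \<D>" using that by simp
    have "(\<lambda>n. a (Suc n) * z ^ Suc n) sums 0"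
      using sums_diff[OF L(4)[OF z] M(4)[OF z]] LM[OF z] by (simp add: a_def algebra_simps)
    then show ?thesis
      by (subst (asm) sums_Suc_iff) (simp add: a_def)
  qed
  then have sums0: "(\<lambda>n. fps_nth (Abs_fps a) n * z ^ n) sums 0" if "z \<in> \<D>" for z
    using that by simp
  have "(\<lambda>_. 0) has_fps_expansion Abs_fps a"
    by (rule has_fps_expansionI, rule eventually_nhds[THEN iffD2], rule exI[of _ "\<D>"])
       (use sums0 in auto)
  then have "Abs_fps a = 0"
    using fps_expansion_unique_complex has_fps_expansion_0 by blast
  then have "a n = 0"
    by (metis fps_nth_Abs_fps fps_zero_nth)
  then show ?thesis using assms(3) by (simp add: a_def)
qed

end

theory Submission
  imports Defs
begin

text \<open>
  Write \<open>\<omega> z = c\<^sub>1 z + c\<^sub>2 z\<^sup>2 + \<dots>\<close> for the Schwarz function of \<open>f\<close>. Comparing coefficients gives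
  \<open>48 \<gamma>\<^sub>2 = 4 B\<^sub>1 c\<^sub>2 + (4 B\<^sub>2 + B\<^sub>1\<^sup>2) c\<^sub>1\<^sup>2\<close> and
  \<open>24 \<gamma>\<^sub>3 = B\<^sub>1 (c\<^sub>3 + \<mu>\<^sub>2 c\<^sub>1 c\<^sub>2 + \<nu>\<^sub>2 c\<^sub>1\<^sup>3)\<close>. The first is bounded by \<open>\<bar>c\<^sub>2\<bar> \<le> 1 - \<bar>c\<^sub>1\<bar>\<^sup>2\<close>, the
  second by the inequality of Prokhorov and Szynal, which the Schur parametrization of
  \<open>(c\<^sub>1, c\<^sub>2, c\<^sub>3)\<close> reduces to the nonnegativity of an explicit polynomial. The choice
  \<open>\<omega> z = \<i> z\<close> makes \<open>\<gamma>\<^sub>2\<^sup>2\<close> and \<open>- \<gamma>\<^sub>3\<^sup>2\<close> both maximal and nonnegative; that the resulting \<open>f\<close> is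
  univalent follows from convex \<open>\<Longrightarrow>\<close> starlike \<open>\<Longrightarrow>\<close> univalent.
\<close>

section \<open>The inequality of Prokhorov and Szynal\<close>

text \<open>Here \<open>q\<close>, \<open>T\<close>, \<open>a\<close> stand for |c|^2, |x|^2 and the
  real part of the rotated \<open>x\<close>. After multiplication by \<nu> the square in
  \<open>a\<close> is completed; what remains is \<nu> - 1 and 12 \<nu> - 8 - \<mu>^2 with
  nonnegative factors.\<close>

lemma prokhorov_szynal_polynomial:
  fixes \<mu> \<nu> q T a :: real
  assumes "1 \<le> \<nu>" "\<mu>\<^sup>2 + 8 \<le> 12 * \<nu>" "0 \<le> q" "q \<le> 1" "0 \<le> T" "T \<le> 1"
  shows "0 \<le> \<nu>\<^sup>2 * (1 + q + q\<^sup>2) - 2 * \<nu> * (1 - T) + (1 - q) * (1 - T)\<^sup>2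
             - 2 * \<nu> * q\<^sup>2 * (\<mu> * a - 2 * a\<^sup>2 + T) - (1 - q) * q * T * (\<mu>\<^sup>2 - 2 * \<mu> * a + T)"
    (is "0 \<le> ?G")
proof -
  define K where "K = \<nu> * (\<nu> - 1) + 2 * q * \<nu>\<^sup>2 + 2 * \<nu> * (1 - 2 * q) * T - 2 * (1 - q) * T\<^sup>2"
  \<comment> \<open>\<open>K\<close> is affine in \<open>q\<close>; the right-hand side interpolates
    between its values at 0 and 1, both nonnegative because 0 \<le> T \<le> 1 \<le> \<nu>.\<close>
  have "K = (1 - q) * (\<nu> * (\<nu> - 1) + 2 * T * (\<nu> - T)) + q * (\<nu> * (3 * \<nu> - 1 - 2 * T))"
    unfolding K_def by (simp add: algebra_simps power2_eq_square)
  also have "\<dots> \<ge> 0"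
    using assms by (intro add_nonneg_nonneg mult_nonneg_nonneg) auto
  finally have K: "0 \<le> K" .
  have "\<nu> * ?G = (2 * \<nu> * q * a - \<mu> * (\<nu> * q - (1 - q) * T) / 2)\<^sup>2 + (1 - q) * (\<nu> - 1) * K
      + (12 * \<nu> - 8 - \<mu>\<^sup>2) * ((1 - q) * q * T * \<nu> + (\<nu> * q - (1 - q) * T)\<^sup>2 / 4)"
    unfolding K_def by (simp add: field_simps power2_eq_square)
  also have "\<dots> \<ge> 0"
    using assms K by (intro add_nonneg_nonneg mult_nonneg_nonneg) auto
  finally have "0 \<le> \<nu> * ?G" .
  with \<open>1 \<le> \<nu>\<close> show ?thesis
    by (simp add: zero_le_mult_iff)
qed

text \<open>The functional c_3 + \<mu> c_1 c_2 + \<nu> c_1^3 in Schur parameters, on a region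
  containing \<open>D1\<close>, \<open>D2\<close> and the points (4, 2), (-4, 2). A rotation makes
  \<open>c\<close> real, the triangle inequality removes \<open>y\<close>, and the difference of
  squares that remains is \<open>s\<close> times the polynomial above.\<close>

lemma prokhorov_szynal_parabola:
  fixes \<mu> \<nu> :: real and c x y :: complex
  assumes "1 \<le> \<nu>" "\<mu>\<^sup>2 + 8 \<le> 12 * \<nu>" "cmod c \<le> 1" "cmod x \<le> 1" "cmod y \<le> 1"
  defines "s \<equiv> 1 - (cmod c)\<^sup>2"
  shows "cmod (s * ((1 - (cmod x)\<^sup>2) * y - cnj c * x\<^sup>2) + \<mu> * c * (s * x) + \<nu> * c ^ 3) \<le> \<nu>"
proof -
  \<comment> \<open>Passing from \<omega>(z) to \<omega>(\<open>cnj u\<close> z) multiplies the n-th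
    coefficient by \<open>cnj u ^ n\<close>: \<open>c\<close> becomes \<open>r\<close> and
    \<open>x\<close> becomes \<open>w\<close>. With \<open>cis (Arg c)\<close> the modulus of
    \<open>u\<close> is 1 even for c = 0.\<close>
  define r u where "r = cmod c" and "u = cis (Arg c)"
  define w where "w = x * (cnj u)\<^sup>2"
  have u: "cmod u = 1" "c = r * u"
    using rcis_cmod_Arg[of c] by (simp_all add: u_def r_def rcis_def)
  have uu: "u * cnj u = 1"
    using u(1) by (metis complex_norm_square of_real_1 one_power2)
  have x: "x = u\<^sup>2 * w"
  proof -
    have "u\<^sup>2 * w = (u * cnj u)\<^sup>2 * x" by (simp add: w_def power2_eq_square)
    then show ?thesis by (simp add: uu)
  qed
  have xw: "cmod x = cmod w" using u(1) by (simp add: x norm_mult norm_power)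
  define T where "T = (cmod x)\<^sup>2"
  have T: "0 \<le> T" "T \<le> 1" using assms by (auto simp: T_def power_le_one)
  have TReIm: "T = (Re w)\<^sup>2 + (Im w)\<^sup>2" by (simp add: T_def xw cmod_power2)
  have r: "0 \<le> r" "r \<le> 1" using assms by (auto simp: r_def)
  have s: "s = 1 - r\<^sup>2" "0 \<le> s" "s \<le> 1" using r by (auto simp: s_def r_def power_le_one)
  define N where "N = \<nu> * complex_of_real r ^ 3 + s * r * (\<mu> * w - w\<^sup>2)"
  have "cnj c * x\<^sup>2 = (u * cnj u) * (r * (u ^ 3 * w\<^sup>2))"
    by (simp add: u(2) x power2_eq_square power3_eq_cube ac_simps)
  then have "s * ((1 - (cmod x)\<^sup>2) * y - cnj c * x\<^sup>2) + \<mu> * c * (s * x) + \<nu> * c ^ 3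
      = s * ((1 - T) * y - r * (u ^ 3 * w\<^sup>2)) + \<mu> * (r * u) * (s * (u\<^sup>2 * w)) + \<nu> * (r * u) ^ 3"
    by (simp add: uu T_def flip: u(2) x)
  also have "\<dots> = u ^ 3 * N + s * (1 - T) * y"
    unfolding N_def by (simp add: algebra_simps power2_eq_square power3_eq_cube)
  also have "cmod \<dots> \<le> cmod N + s * (1 - T)"
  proof -
    have "cmod (s * (1 - T) * y) = s * (1 - T) * cmod y"
      using s T by (simp add: norm_mult del: of_real_diff of_real_mult flip: of_real_mult)
    also have "\<dots> \<le> s * (1 - T) * 1"
      using s T assms by (intro mult_left_mono) auto
    finally show ?thesis
      using norm_triangle_ineq[of "u ^ 3 * N" "s * (1 - T) * y"] u(1)
      by (simp add: norm_mult norm_power)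
  qed
  also have "cmod N \<le> \<nu> - s * (1 - T)"
  proof (rule power2_le_imp_le)
    have "s * (1 - T) \<le> 1 * 1" using s T by (intro mult_mono) auto
    with assms show "0 \<le> \<nu> - s * (1 - T)" by simp
    \<comment> \<open>The two squares to be compared agree at r = 1, which accounts for the factor
      \<open>s\<close>; \<open>G\<close> is the cofactor, with \<open>Im w\<close> eliminated
      through \<open>T\<close>.\<close>
    define G where "G = \<nu>\<^sup>2 * (1 + r\<^sup>2 + (r\<^sup>2)\<^sup>2) - 2 * \<nu> * (1 - T) + (1 - r\<^sup>2) * (1 - T)\<^sup>2
       - 2 * \<nu> * (r\<^sup>2)\<^sup>2 * (\<mu> * Re w - 2 * (Re w)\<^sup>2 + T)
       - (1 - r\<^sup>2) * r\<^sup>2 * T * (\<mu>\<^sup>2 - 2 * \<mu> * Re w + T)"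
    have "0 \<le> G"
      unfolding G_def using assms T r
      by (intro prokhorov_szynal_polynomial) (auto simp: power_le_one)
    have ReN: "Re N = \<nu> * r ^ 3 + s * r * (\<mu> * Re w - ((Re w)\<^sup>2 - (Im w)\<^sup>2))"
      unfolding N_def by (simp add: power2_eq_square power3_eq_cube)
    have ImN: "Im N = s * r * (\<mu> * Im w - 2 * Re w * Im w)"
      unfolding N_def by (simp add: power2_eq_square power3_eq_cube)
    have "(\<nu> - s * (1 - T))\<^sup>2 - (cmod N)\<^sup>2 = s * G"
      unfolding cmod_power2 ReN ImN G_def TReIm s(1) by algebra
    with \<open>0 \<le> G\<close> s show "(cmod N)\<^sup>2 \<le> (\<nu> - s * (1 - T))\<^sup>2"
      by (metis diff_ge_0_iff_ge mult_nonneg_nonneg)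
  qed
  finally show ?thesis by simp
qed

text \<open>
  The half-lines bounding \<^const>\<open>D3\<close> are tangent to the parabola \<open>12 * \<nu> = \<mu>\<^sup>2 + 8\<close> at
  \<open>(\<plusminus>4, 2)\<close>; moving along them from the point of tangency costs at most
  \<open>r * (1 - r\<^sup>2) \<le> 2 / 3 * (1 - r ^ 3)\<close>.
\<close>
lemma prokhorov_szynal:
  fixes \<mu> \<nu> :: real and c x y :: complex
  assumes D: "(\<mu>, \<nu>) \<in> D1 \<union> D2 \<union> D3" and "cmod c \<le> 1" "cmod x \<le> 1" "cmod y \<le> 1"
  defines "s \<equiv> 1 - (cmod c)\<^sup>2"
  shows "cmod (s * ((1 - (cmod x)\<^sup>2) * y - cnj c * x\<^sup>2) + \<mu> * c * (s * x) + \<nu> * c ^ 3) \<le> \<nu>"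
proof (cases "(\<mu>, \<nu>) \<in> D3")
  case False
  \<comment> \<open>\<open>D1\<close> and \<open>D2\<close> each supply one of the two conditions;
    the other follows from |\<mu>| \<le> 2 and 2 \<le> |\<mu>| respectively.\<close>
  have "1 \<le> \<nu> \<and> \<mu>\<^sup>2 + 8 \<le> 12 * \<nu>"
  proof (cases "(\<mu>, \<nu>) \<in> D1")
    case True
    then have "\<mu>\<^sup>2 \<le> 2\<^sup>2" by (subst abs_le_square_iff[symmetric]) (auto simp: D1_def)
    with True show ?thesis by (auto simp: D1_def)
  next
    case False
    with \<open>(\<mu>, \<nu>) \<notin> D3\<close> D have "2 \<le> \<bar>\<mu>\<bar>" "1 / 12 * (\<mu>\<^sup>2 + 8) \<le> \<nu>" by (auto simp: D2_def)
    moreover from this(1) have "2\<^sup>2 \<le> \<mu>\<^sup>2" by (subst abs_le_square_iff[symmetric]) simp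
    ultimately show ?thesis by simp
  qed
  then show ?thesis
    unfolding s_def using assms by (intro prokhorov_szynal_parabola) auto
next
  case True
  then have "\<bar>\<mu>\<bar> \<ge> 4" and \<nu>: "2 / 3 * (\<bar>\<mu>\<bar> - 1) \<le> \<nu>" by (auto simp: D3_def)
  define \<mu>\<^sub>0 where "\<mu>\<^sub>0 = (if \<mu> \<ge> 0 then 4 else - 4 :: real)"
  define r where "r = cmod c"
  have r: "0 \<le> r" "r \<le> 1" using assms by (auto simp: r_def)
  then have s: "s = 1 - r\<^sup>2" "0 \<le> s" by (auto simp: s_def r_def power_le_one)
  define d where "d = \<bar>\<mu> - \<mu>\<^sub>0\<bar>"
  have "d = \<bar>\<mu>\<bar> - 4"
    using \<open>\<bar>\<mu>\<bar> \<ge> 4\<close> by (auto simp: d_def \<mu>\<^sub>0_def)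
  then have d: "0 \<le> d" "\<nu> \<ge> 2 + 2 / 3 * d"
    using \<open>\<bar>\<mu>\<bar> \<ge> 4\<close> \<nu> by (simp_all add: field_simps)
  let ?c3 = "s * ((1 - (cmod x)\<^sup>2) * y - cnj c * x\<^sup>2)"
  \<comment> \<open>The point of tangency meets the parabola condition with equality: 4^2 + 8 = 12 *
    2.\<close>
  have A: "cmod (?c3 + \<mu>\<^sub>0 * c * (s * x) + (2 :: real) * c ^ 3) \<le> 2"
    unfolding s_def using assms by (intro prokhorov_szynal_parabola) (auto simp: \<mu>\<^sub>0_def)
  have "cmod (c * (s * x)) = r * s * cmod x"
    using s(2) by (simp add: norm_mult r_def)
  also have "\<dots> \<le> r * s * 1"
    using r s assms by (intro mult_left_mono) auto
  finally have "cmod (complex_of_real (\<mu> - \<mu>\<^sub>0) * (c * (s * x))) \<le> d * (r * s)"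
    by (simp add: norm_mult d_def mult_left_mono flip: of_real_diff)
  moreover have "r * s \<le> 2 / 3 * (1 - r ^ 3)"
  proof -
    have "2 / 3 * (1 - r ^ 3) - r * s = (1 - r)\<^sup>2 * (r + 2) / 3"
      unfolding s by (simp add: field_simps power2_eq_square power3_eq_cube)
    also have "\<dots> \<ge> 0" using r by simp
    finally show ?thesis by simp
  qed
  then have "d * (r * s) \<le> d * (2 / 3 * (1 - r ^ 3))"
    using d by (intro mult_left_mono)
  ultimately have B: "cmod (complex_of_real (\<mu> - \<mu>\<^sub>0) * (c * (s * x))) \<le> d * (2 / 3 * (1 - r ^ 3))"
    by linarith
  have C: "cmod (complex_of_real (\<nu> - 2) * c ^ 3) \<le> (\<nu> - 2) * r ^ 3"
    using d by (simp add: norm_mult norm_power r_def flip: of_real_diff)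
  have "?c3 + \<mu> * c * (s * x) + \<nu> * c ^ 3
      = (?c3 + \<mu>\<^sub>0 * c * (s * x) + (2 :: real) * c ^ 3)
        + complex_of_real (\<mu> - \<mu>\<^sub>0) * (c * (s * x)) + complex_of_real (\<nu> - 2) * c ^ 3"
    by (simp add: algebra_simps)
  also have "cmod \<dots> \<le> 2 + d * (2 / 3 * (1 - r ^ 3)) + (\<nu> - 2) * r ^ 3"
    by (intro norm_triangle_mono A B C)
  \<comment> \<open>The increase of \<nu> beyond 2 pays for the shift of \<mu>, since \<nu> - 2 is
    at least 2/3 \<open>d\<close>.\<close>
  also have "\<dots> = \<nu> - (\<nu> - 2 - 2 / 3 * d) * (1 - r ^ 3)"
    by (simp add: algebra_simps)
  also have "\<dots> \<le> \<nu>"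
    using d r by (simp add: power_le_one)
  finally show ?thesis .
qed

section \<open>Schur parameters\<close>

lemma fps_eq_if_eq_on_disc:
  assumes "f has_fps_expansion F" "g has_fps_expansion G" "\<And>z. z \<in> \<D> \<Longrightarrow> f z = g z"
  shows "F = G"
proof -
  have "eventually (\<lambda>z. z \<in> \<D>) (nhds 0)"
    by (intro eventually_nhds_in_open) auto
  then have "eventually (\<lambda>z. f z = g z) (nhds 0)"
    by eventually_elim (use assms(3) in auto)
  then have "g has_fps_expansion F"
    using assms(1) has_fps_expansion_cong[of f g F F] by simp
  with assms(2) show ?thesis
    by (rule fps_expansion_unique_complex[symmetric])
qed

lemma has_fps_expansion_disc:
  "f holomorphic_on \<D> \<Longrightarrow> f has_fps_expansion fps_expansion f 0"
  by (rule has_fps_expansion_fps_expansion[of \<D>]) auto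

text \<open>One step of the Schur algorithm: \<open>h\<close> is the Moebius transform of
  \<open>g\<close> sending \<open>g 0\<close> to 0, divided by z, and the Schwarz lemma bounds it.
  The relation is written without a denominator so that it also covers constants, for which that
  denominator can vanish.\<close>

lemma schur_step:
  assumes g: "g holomorphic_on \<D>" and le: "\<And>z. z \<in> \<D> \<Longrightarrow> cmod (g z) \<le> 1"
  obtains h where "h holomorphic_on \<D>" "\<And>z. z \<in> \<D> \<Longrightarrow> cmod (h z) \<le> 1"
    "\<And>z. z \<in> \<D> \<Longrightarrow> g z - g 0 = z * h z * (1 - cnj (g 0) * g z)"
proof (cases "g constant_on \<D>")
  case True
  then have "g z - g 0 = 0" if "z \<in> \<D>" for z
    using that unfolding constant_on_def by (metis centre_in_ball diff_self zero_less_one)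
  then show ?thesis by (intro that[of "\<lambda>_. 0"]) (simp_all only: mult_zero_left mult_zero_right, auto)
next
  case False
  \<comment> \<open>By the maximum principle a nonconstant \<open>g\<close> has its values in the
    open disc, as the Moebius map requires.\<close>
  have lt: "cmod (g z) < 1" if z: "z \<in> \<D>" for z
  proof (rule ccontr)
    assume "\<not> cmod (g z) < 1"
    then have "g constant_on \<D>"
      using le z by (intro maximum_modulus_principle[where U = \<D> and \<xi> = z, OF g])
        (auto simp del: mem_ball intro: order_trans[OF le])
    with False show False by contradiction
  qed
  define k where "k = Moebius_function 0 (g 0) \<circ> g"
  have g0: "cmod (g 0) < 1" by (simp add: lt)
  have holk: "k holomorphic_on \<D>"
    unfolding k_def
    by (intro holomorphic_on_compose_gen[OF g Moebius_function_holomorphic[OF g0]]) (use lt in auto)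
  have k0: "k 0 = 0" by (simp add: k_def Moebius_function_eq_zero)
  have klt: "cmod (k z) < 1" if "cmod z < 1" for z
    using Moebius_function_norm_lt_1[OF g0 lt[of z]] that by (simp add: k_def)
  obtain h where h: "h holomorphic_on \<D>" "\<And>z. cmod z < 1 \<Longrightarrow> k z = z * h z" "deriv k 0 = h 0"
    using Schwarz3[OF holk k0] by blast
  show ?thesis
  proof (rule that[OF h(1)])
    fix z assume z: "z \<in> \<D>"
    \<comment> \<open>Division by z fails at 0; there \<open>h 0\<close> is the derivative of
      \<open>k\<close>, which the Schwarz lemma bounds too.\<close>
    show "cmod (h z) \<le> 1"
    proof (cases "z = 0")
      case True
      then show ?thesis using Schwarz_Lemma(2)[OF holk k0 klt, of 0] h(3) by simp
    next
      case False
      have "cmod (k z) \<le> cmod z" using Schwarz_Lemma(1)[OF holk k0 klt, of z] z by simp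
      with False h(2)[of z] z show ?thesis by (simp add: norm_mult)
    qed
    have "cmod (cnj (g 0) * g z) < 1"
      using mult_strict_mono'[OF g0 lt[OF z]] by (simp add: norm_mult)
    then have "1 - cnj (g 0) * g z \<noteq> 0" by auto
    then show "g z - g 0 = z * h z * (1 - cnj (g 0) * g z)"
      using h(2)[of z] z by (simp add: k_def Moebius_function_simple field_simps)
  qed
qed

lemma schur_step_fps:
  assumes g: "g holomorphic_on \<D>" and le: "\<And>z. z \<in> \<D> \<Longrightarrow> cmod (g z) \<le> 1"
  obtains h where "h holomorphic_on \<D>" "\<And>z. z \<in> \<D> \<Longrightarrow> cmod (h z) \<le> 1"
    "fps_expansion g 0 - fps_const (g 0) =
       fps_X * fps_expansion h 0 * (1 - fps_const (cnj (g 0)) * fps_expansion g 0)"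
proof -
  obtain h where h: "h holomorphic_on \<D>" "\<And>z. z \<in> \<D> \<Longrightarrow> cmod (h z) \<le> 1"
    "\<And>z. z \<in> \<D> \<Longrightarrow> g z - g 0 = z * h z * (1 - cnj (g 0) * g z)"
    using schur_step[OF assms] by blast
  show ?thesis
    using h
    by (intro that[of h] fps_eq_if_eq_on_disc[of "\<lambda>z. g z - g 0" _ "\<lambda>z. z * h z * (1 - cnj (g 0) * g z)"]
        fps_expansion_intros has_fps_expansion_disc g)
qed

text \<open>Three Schur steps lead from \<omega> to \<open>g1\<close>, \<open>g2\<close>,
  \<open>g3\<close>, and the parameters are c_1 = \<open>g1 0\<close>, x = \<open>g2 0\<close>, y =
  \<open>g3 0\<close>. Since \<omega> vanishes at 0, the first step is division by z and shifts
  coefficients by one.\<close>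

lemma schwarz_function_coeffs:
  fixes c :: "nat \<Rightarrow> complex"
  assumes "schwarz_function \<omega>"
  defines "c \<equiv> fps_nth (fps_expansion \<omega> 0)"
  obtains x y :: complex where "cmod (c 1) \<le> 1" "cmod x \<le> 1" "cmod y \<le> 1"
    "c 2 = (1 - (cmod (c 1))\<^sup>2) * x"
    "c 3 = (1 - (cmod (c 1))\<^sup>2) * ((1 - (cmod x)\<^sup>2) * y - cnj (c 1) * x\<^sup>2)"
proof -
  have \<omega>: "\<omega> holomorphic_on \<D>" "\<And>z. z \<in> \<D> \<Longrightarrow> cmod (\<omega> z) \<le> 1" "\<omega> 0 = 0"
    using assms(1) by (force simp: schwarz_function_def image_subset_iff)+
  obtain g1 where g1: "g1 holomorphic_on \<D>" "\<And>z. z \<in> \<D> \<Longrightarrow> cmod (g1 z) \<le> 1"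
    and e1: "fps_expansion \<omega> 0 - fps_const (\<omega> 0) =
       fps_X * fps_expansion g1 0 * (1 - fps_const (cnj (\<omega> 0)) * fps_expansion \<omega> 0)"
    using schur_step_fps[OF \<omega>(1,2)] by blast
  obtain g2 where g2: "g2 holomorphic_on \<D>" "\<And>z. z \<in> \<D> \<Longrightarrow> cmod (g2 z) \<le> 1"
    and e2: "fps_expansion g1 0 - fps_const (g1 0) =
       fps_X * fps_expansion g2 0 * (1 - fps_const (cnj (g1 0)) * fps_expansion g1 0)"
    using schur_step_fps[OF g1] by blast
  obtain g3 where g3: "g3 holomorphic_on \<D>" "\<And>z. z \<in> \<D> \<Longrightarrow> cmod (g3 z) \<le> 1"
    and e3: "fps_expansion g2 0 - fps_const (g2 0) =
       fps_X * fps_expansion g3 0 * (1 - fps_const (cnj (g2 0)) * fps_expansion g2 0)"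
    using schur_step_fps[OF g2] by blast
  have nth0: "fps_nth (fps_expansion h 0) 0 = h 0" for h :: "complex \<Rightarrow> complex"
    by (simp add: fps_expansion_def)
  have norm_sq: "z * cnj z = (cmod z)\<^sup>2" "cnj z * z = (cmod z)\<^sup>2" for z
    using complex_norm_square[of z] by (simp_all add: mult.commute)
  have W: "fps_expansion \<omega> 0 = fps_X * fps_expansion g1 0"
    using e1 by (simp add: \<omega>)
  have c: "c 1 = g1 0" "c 2 = fps_nth (fps_expansion g1 0) 1" "c 3 = fps_nth (fps_expansion g1 0) 2"
    by (simp_all add: c_def W nth0)
  \<comment> \<open>Because of the factor \<open>fps_X\<close>, coefficient n + 1 of
    \<open>G\<close> depends on \<open>G\<close> and \<open>H\<close> only up to index n, so the
    coefficients are found recursively.\<close>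
  have coeff: "fps_nth G (Suc n) = fps_nth (H * (1 - fps_const (cnj a) * G)) n"
    if "G - fps_const a = fps_X * H * (1 - fps_const (cnj a) * G)" for G H :: "complex fps" and a n
    using arg_cong[OF that, of "\<lambda>F. fps_nth F (Suc n)"] by (simp add: mult.assoc)
  have x1: "fps_nth (fps_expansion g2 0) 1 = g3 0 * (1 - (cmod (g2 0))\<^sup>2)"
    using coeff[OF e3, of 0] by (simp add: nth0 norm_sq)
  have c2: "fps_nth (fps_expansion g1 0) 1 = g2 0 * (1 - (cmod (g1 0))\<^sup>2)"
    using coeff[OF e2, of 0] by (simp add: nth0 norm_sq)
  have c3: "fps_nth (fps_expansion g1 0) 2 =
     g2 0 * (- cnj (g1 0) * (g2 0 * (1 - (cmod (g1 0))\<^sup>2))) + g3 0 * (1 - (cmod (g2 0))\<^sup>2) * (1 - (cmod (g1 0))\<^sup>2)"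
    using coeff[OF e2, of 1] x1 c2
    by (simp add: fps_mult_nth_1 nth0 norm_sq numeral_2_eq_2)
  show ?thesis
    by (rule that[of "g2 0" "g3 0"]) (use g1 g2 g3 c c2 c3 in \<open>simp_all add: algebra_simps power2_eq_square\<close>)
qed

section \<open>Logarithmic coefficients\<close>

lemma fps_mult_nth_2:
  "fps_nth (f * g) 2 = fps_nth f 0 * fps_nth g 2 + fps_nth f 1 * fps_nth g 1 + fps_nth f 2 * fps_nth g 0"
  by (simp add: fps_mult_nth eval_nat_numeral)

lemma fps_mult_nth_3:
  "fps_nth (f * g) 3 = fps_nth f 0 * fps_nth g 3 + fps_nth f 1 * fps_nth g 2
     + fps_nth f 2 * fps_nth g 1 + fps_nth f 3 * fps_nth g 0"
  by (simp add: fps_mult_nth eval_nat_numeral)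

lemma fps_mult_nth_4:
  "fps_nth (f * g) 4 = fps_nth f 0 * fps_nth g 4 + fps_nth f 1 * fps_nth g 3 + fps_nth f 2 * fps_nth g 2
     + fps_nth f 3 * fps_nth g 1 + fps_nth f 4 * fps_nth g 0"
  by (simp add: fps_mult_nth eval_nat_numeral)

lemma fps_compose_nth_low:
  fixes F G :: "'a :: comm_ring_1 fps"
  assumes "fps_nth G 0 = 0"
  shows "fps_nth (F oo G) 1 = fps_nth F 1 * fps_nth G 1"
    and "fps_nth (F oo G) 2 = fps_nth F 1 * fps_nth G 2 + fps_nth F 2 * (fps_nth G 1)\<^sup>2"
    and "fps_nth (F oo G) 3 = fps_nth F 1 * fps_nth G 3 + 2 * fps_nth F 2 * fps_nth G 1 * fps_nth G 2
           + fps_nth F 3 * fps_nth G 1 ^ 3"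
proof -
  have "(\<Sum>i=0..2. h i) = h 0 + h 1 + h 2" "(\<Sum>i=0..3. h i) = h 0 + h 1 + h 2 + h 3" for h :: "nat \<Rightarrow> 'a"
    by (simp_all add: eval_nat_numeral)
  then show "fps_nth (F oo G) 1 = fps_nth F 1 * fps_nth G 1"
    and "fps_nth (F oo G) 2 = fps_nth F 1 * fps_nth G 2 + fps_nth F 2 * (fps_nth G 1)\<^sup>2"
    and "fps_nth (F oo G) 3 = fps_nth F 1 * fps_nth G 3 + 2 * fps_nth F 2 * fps_nth G 1 * fps_nth G 2
           + fps_nth F 3 * fps_nth G 1 ^ 3"
    using assms
    by (simp_all add: fps_compose_nth power2_eq_square power3_eq_cube fps_mult_nth_2 fps_mult_nth_3 algebra_simps)
qed

text \<open>The hypothesis on f gives z f'' = f' (\<phi> o \<omega> - 1), which determines the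
  coefficients of f; differentiating f = z exp L gives z f' = f (1 + z L'), which then determines
  \<gamma>. Eliminating the coefficients of f leaves those of \<phi> o \<omega>.\<close>

lemma log_coeffs_2_3:
  fixes P c :: "nat \<Rightarrow> complex"
  assumes f: "f \<in> class_S" and \<phi>: "\<phi> holomorphic_on \<D>" "\<phi> 0 = 1" and \<omega>: "schwarz_function \<omega>"
    and eq: "\<And>z. z \<in> \<D> \<Longrightarrow> 1 + z * deriv (deriv f) z / deriv f z = \<phi> (\<omega> z)"
    and \<gamma>: "log_coeffs f \<gamma>"
  defines "P \<equiv> fps_nth (fps_expansion \<phi> 0)" and "c \<equiv> fps_nth (fps_expansion \<omega> 0)"
  shows "\<gamma> 2 = (4 * P 1 * c 2 + (4 * P 2 + (P 1)\<^sup>2) * (c 1)\<^sup>2) / 48"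
    and "\<gamma> 3 = (2 * P 1 * c 3 + (4 * P 2 + (P 1)\<^sup>2) * c 1 * c 2 + (2 * P 3 + P 1 * P 2) * c 1 ^ 3) / 48"
proof -
  from f have hf: "f holomorphic_on \<D>" and inj: "inj_on f \<D>" and f0: "f 0 = 0" "deriv f 0 = 1"
    by (auto simp: class_S_def)
  from \<omega> have h\<omega>: "\<omega> holomorphic_on \<D>" and \<omega>0: "\<omega> 0 = 0"
    by (auto simp: schwarz_function_def)
  obtain L where L: "L holomorphic_on \<D>" "L 0 = 0" "\<And>z. z \<in> \<D> - {0} \<Longrightarrow> exp (L z) = f z / z"
      "\<And>z. z \<in> \<D> \<Longrightarrow> (\<lambda>n. 2 * (\<gamma> (Suc n) * z ^ Suc n)) sums L z"
    using \<gamma> unfolding log_coeffs_def by metis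
  \<comment> \<open>The constant term of \<open>G\<close> is set to 0 because
    \<open>\<gamma> 0\<close> is arbitrary.\<close>
  define F W G where "F = fps_expansion f 0" and "W = fps_expansion \<omega> 0"
    and "G = Abs_fps (\<lambda>n. if n = 0 then 0 else 2 * \<gamma> n)"
  have F: "f has_fps_expansion F" and W: "\<omega> has_fps_expansion W"
    and P: "\<phi> has_fps_expansion fps_expansion \<phi> 0"
    unfolding F_def W_def by (rule has_fps_expansion_disc, fact)+
  have nth0: "fps_nth F 0 = 0" "fps_nth F 1 = 1" "fps_nth W 0 = 0" "P 0 = 1"
    by (simp_all add: F_def W_def P_def fps_expansion_def f0 \<omega>0 \<phi>)
  have cW: "fps_nth W n = c n" for n
    by (simp add: c_def W_def)
  have fz: "f z = z * exp (L z)" if "z \<in> \<D>" for z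
    using L(3)[of z] that by (cases "z = 0") (auto simp: f0)
  have G: "L has_fps_expansion G"
  proof (rule has_fps_expansionI)
    have "eventually (\<lambda>z. z \<in> \<D>) (nhds 0)"
      by (intro eventually_nhds_in_open) auto
    then show "eventually (\<lambda>z. (\<lambda>n. fps_nth G n * z ^ n) sums L z) (nhds 0)"
    proof eventually_elim
      case (elim z)
      have "(\<lambda>n. fps_nth G (Suc n) * z ^ Suc n) sums L z"
        using L(4)[OF elim] by (simp add: G_def mult.assoc)
      then show ?case
        by (subst (asm) sums_Suc_iff) (simp add: G_def)
    qed
  qed
  have "fps_X * fps_deriv (fps_deriv F) = fps_deriv F * ((fps_expansion \<phi> 0 oo W) - 1)"
  proof (rule fps_eq_if_eq_on_disc)
    show "(\<lambda>z. z * deriv (deriv f) z) has_fps_expansion fps_X * fps_deriv (fps_deriv F)"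
      by (intro fps_expansion_intros F)
    show "(\<lambda>z. deriv f z * ((\<phi> \<circ> \<omega>) z - 1)) has_fps_expansion
        fps_deriv F * ((fps_expansion \<phi> 0 oo W) - 1)"
      by (intro fps_expansion_intros F P W nth0)
    fix z assume z: "z \<in> \<D>"
    have "deriv f z \<noteq> 0"
      using holomorphic_injective_imp_regular[OF hf _ inj z] by simp
    with eq[OF z] show "z * deriv (deriv f) z = deriv f z * ((\<phi> \<circ> \<omega>) z - 1)"
      by (simp add: field_simps)
  qed
  note e = arg_cong[OF this, where f = "\<lambda>H. fps_nth H n" for n]
  have "fps_X * fps_deriv F = F * (1 + fps_X * fps_deriv G)"
  proof (rule fps_eq_if_eq_on_disc)
    show "(\<lambda>z. z * deriv f z) has_fps_expansion fps_X * fps_deriv F"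
      by (intro fps_expansion_intros F)
    show "(\<lambda>z. f z * (1 + z * deriv L z)) has_fps_expansion F * (1 + fps_X * fps_deriv G)"
      by (intro fps_expansion_intros F G)
    fix z assume z: "z \<in> \<D>"
    have "(L has_field_derivative deriv L z) (at z)"
      using holomorphic_derivI[OF L(1) _ z] by simp
    then have "((\<lambda>z. z * exp (L z)) has_field_derivative exp (L z) + z * (exp (L z) * deriv L z)) (at z)"
      by (auto intro!: derivative_eq_intros)
    then have "(f has_field_derivative exp (L z) + z * (exp (L z) * deriv L z)) (at z)"
      by (rule has_field_derivative_transform_within_open[of _ _ _ \<D>]) (use z fz in auto)
    then show "z * deriv f z = f z * (1 + z * deriv L z)"
      by (simp add: DERIV_imp_deriv fz[OF z] algebra_simps)
  qed
  note l = arg_cong[OF this, where f = "\<lambda>H. fps_nth H n" for n]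
  let ?a = "fps_nth F" and ?M = "fps_nth (fps_expansion \<phi> 0 oo W)"
  note M = fps_compose_nth_low[OF nth0(3), of "fps_expansion \<phi> 0", unfolded cW, folded P_def]
  have M0: "?M 0 = 1" using nth0(4) by (simp add: P_def)
  \<comment> \<open>Coefficient n of z f'' is n (n + 1) a_(n+1); these are the cases n = 1, 2,
    3.\<close>
  have a: "2 * ?a 2 = ?M 1" "6 * ?a 3 = ?M 2 + 2 * ?a 2 * ?M 1"
    "12 * ?a 4 = ?M 3 + 2 * ?a 2 * ?M 2 + 3 * ?a 3 * ?M 1"
    using e[of 1] e[of 2] e[of 3] nth0(1,2) M0
    by (simp_all add: fps_mult_nth_2 fps_mult_nth_3 numeral_2_eq_2[symmetric] algebra_simps)
  have Gn: "fps_nth G n = 2 * \<gamma> n" if "n > 0" for n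
    using that by (simp add: G_def)
  \<comment> \<open>The cases n = 2, 3, 4 of (n - 1) a_n = sum of 2 k \<gamma>_k a_(n-k) over 0 < k
    < n.\<close>
  have g: "2 * \<gamma> 1 = ?a 2" "4 * \<gamma> 2 = 2 * ?a 3 - 2 * \<gamma> 1 * ?a 2"
    "6 * \<gamma> 3 = 3 * ?a 4 - 4 * \<gamma> 2 * ?a 2 - 2 * \<gamma> 1 * ?a 3"
    using l[of 2] l[of 3] l[of 4] nth0(1,2)
    by (simp_all add: fps_mult_nth_2 fps_mult_nth_3 fps_mult_nth_4 numeral_2_eq_2[symmetric] Gn algebra_simps)
  have a2: "?a 2 = ?M 1 / 2" using a(1) by (simp add: field_simps)
  have "?a 3 = (6 * ?a 3) / 6" by simp
  also have "\<dots> = (?M 2 + (?M 1)\<^sup>2) / 6" unfolding a(2) a2 by (simp add: power2_eq_square)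
  finally have a3: "?a 3 = (?M 2 + (?M 1)\<^sup>2) / 6" .
  have "?a 4 = (12 * ?a 4) / 12" by simp
  also have "\<dots> = (2 * ?M 3 + 3 * ?M 1 * ?M 2 + ?M 1 ^ 3) / 24"
    unfolding a(3) a2 a3 by (simp add: field_simps power2_eq_square power3_eq_cube)
  finally have a4: "?a 4 = (2 * ?M 3 + 3 * ?M 1 * ?M 2 + ?M 1 ^ 3) / 24" .
  have g1: "2 * \<gamma> 1 = ?M 1 / 2" using g(1) a2 by simp
  have "48 * \<gamma> 2 = 12 * (4 * \<gamma> 2)" by simp
  also have "\<dots> = 4 * ?M 2 + (?M 1)\<^sup>2"
    unfolding g(2) g1 a2 a3 by (simp add: field_simps power2_eq_square)
  finally have g2: "48 * \<gamma> 2 = 4 * ?M 2 + (?M 1)\<^sup>2" .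
  then have g2': "4 * \<gamma> 2 = (4 * ?M 2 + (?M 1)\<^sup>2) / 12" by (simp add: field_simps)
  have "48 * \<gamma> 3 = 8 * (6 * \<gamma> 3)" by simp
  also have "\<dots> = 2 * ?M 3 + ?M 1 * ?M 2"
    unfolding g(3) g1 g2' a2 a3 a4 by (simp add: field_simps power2_eq_square power3_eq_cube)
  finally have g3: "48 * \<gamma> 3 = 2 * ?M 3 + ?M 1 * ?M 2" .
  show "\<gamma> 2 = (4 * P 1 * c 2 + (4 * P 2 + (P 1)\<^sup>2) * (c 1)\<^sup>2) / 48"
    using g2 unfolding M by (simp add: field_simps power2_eq_square)
  show "\<gamma> 3 = (2 * P 1 * c 3 + (4 * P 2 + (P 1)\<^sup>2) * c 1 * c 2 + (2 * P 3 + P 1 * P 2) * c 1 ^ 3) / 48"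
    using g3 unfolding M by (simp add: field_simps power2_eq_square power3_eq_cube)
qed

section \<open>Symmetry of Ma--Minda functions\<close>

text \<open>The reflected map \<open>\<psi>\<close> takes the disc into the image of \<phi> and has
  the same value and, the derivative being real, the same derivative at 0. So \<open>k\<close>, the
  inverse of \<phi> after \<psi>, is a self-map of the disc with k(0) = 0 and k'(0) = 1, which the
  equality case of the Schwarz lemma makes the identity.\<close>

lemma ma_minda_cnj:
  assumes \<phi>: "ma_minda \<phi>" and z: "z \<in> \<D>"
  shows "cnj (\<phi> (cnj z)) = \<phi> z"
proof -
  have hol: "\<phi> holomorphic_on \<D>" and inj: "inj_on \<phi> \<D>" and \<phi>0: "\<phi> 0 = 1"
    and d: "deriv \<phi> 0 \<in> \<real>" and sym: "cnj ` (\<phi> ` \<D>) = \<phi> ` \<D>"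
    using \<phi> by (auto simp: ma_minda_def)
  have cnjD: "cnj ` \<D> = \<D>"
    by (auto simp: image_cnj_conv_vimage_cnj)
  define \<psi> where "\<psi> = cnj \<circ> \<phi> \<circ> cnj"
  have \<psi>: "\<psi> holomorphic_on \<D>"
    unfolding \<psi>_def by (rule holomorphic_on_compose_cnj_cnj) (use hol cnjD in auto)
  have im: "\<psi> ` \<D> \<subseteq> \<phi> ` \<D>"
    using sym cnjD by (metis \<psi>_def image_comp subset_refl)
  obtain g where g: "g holomorphic_on \<phi> ` \<D>" "\<And>w. w \<in> \<D> \<Longrightarrow> deriv \<phi> w * deriv g (\<phi> w) = 1"
    "\<And>w. w \<in> \<D> \<Longrightarrow> g (\<phi> w) = w"
    using holomorphic_has_inverse[OF hol open_ball inj] by blast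
  define k where "k = g \<circ> \<psi>"
  have k: "k holomorphic_on \<D>"
    unfolding k_def by (rule holomorphic_on_compose_gen[OF \<psi> g(1) im])
  have k0: "k 0 = 0" using g(3)[of 0] by (simp add: k_def \<psi>_def \<phi>0)
  have \<phi>k: "\<phi> (k w) = \<psi> w" "cmod (k w) < 1" if "cmod w < 1" for w
  proof -
    have "\<psi> w \<in> \<phi> ` \<D>" using im that by auto
    then obtain v where "v \<in> \<D>" "\<psi> w = \<phi> v" by (elim imageE)
    then show "\<phi> (k w) = \<psi> w" "cmod (k w) < 1" using g(3) by (auto simp: k_def)
  qed
  have "(\<psi> has_field_derivative cnj (deriv \<phi> 0)) (at 0)"
    unfolding \<psi>_def by (rule has_field_derivative_cnj_cnj) (use holomorphic_derivI[OF hol, of 0] in simp)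
  moreover have "(g has_field_derivative deriv g 1) (at (\<psi> 0))"
    using holomorphic_derivI[OF g(1) open_mapping_thm3[OF hol open_ball inj], of 1] \<phi>0
    by (force simp: \<psi>_def)
  ultimately have "(k has_field_derivative deriv g 1 * cnj (deriv \<phi> 0)) (at 0)"
    unfolding k_def by (intro DERIV_chain)
  then have dk: "deriv k 0 = 1"
    using g(2)[of 0] d by (simp add: \<phi>0 DERIV_imp_deriv Reals_cnj_iff mult.commute)
  obtain \<alpha> where \<alpha>: "\<And>w. cmod w < 1 \<Longrightarrow> k w = \<alpha> * w"
    using Schwarz_Lemma(3)[OF k k0 \<phi>k(2), of 0] dk by auto
  have "(k has_field_derivative \<alpha>) (at 0)"
    by (rule has_field_derivative_transform_within_open[of "\<lambda>w. \<alpha> * w" _ _ \<D>])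
       (use \<alpha> in \<open>auto intro!: derivative_eq_intros\<close>)
  then have "\<alpha> = 1" using dk DERIV_imp_deriv by blast
  with \<alpha>[of z] \<phi>k(1)[of z] z show ?thesis by (simp add: \<psi>_def)
qed

text \<open>Conjugating the series at the conjugate point gives, by the reflection symmetry, a
  second expansion of \<phi>; expansions are unique.\<close>

lemma ma_minda_coeffs_real:
  assumes "ma_minda \<phi>"
  shows "fps_nth (fps_expansion \<phi> 0) n \<in> \<real>"
proof -
  let ?P = "fps_expansion \<phi> 0"
  have hol: "\<phi> holomorphic_on \<D>" using assms by (simp add: ma_minda_def)
  have "\<phi> has_fps_expansion Abs_fps (\<lambda>n. cnj (fps_nth ?P n))"
  proof (rule has_fps_expansionI)
    have "eventually (\<lambda>z. z \<in> \<D>) (nhds 0)"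
      by (intro eventually_nhds_in_open) auto
    then show "eventually (\<lambda>z. (\<lambda>n. fps_nth (Abs_fps (\<lambda>n. cnj (fps_nth ?P n))) n * z ^ n) sums \<phi> z) (nhds 0)"
    proof eventually_elim
      case (elim z)
      then have "(\<lambda>n. fps_nth ?P n * cnj z ^ n) sums \<phi> (cnj z)"
        using holomorphic_power_series[OF hol, of "cnj z"] by (simp add: fps_expansion_def)
      then have "(\<lambda>n. cnj (fps_nth ?P n * cnj z ^ n)) sums cnj (\<phi> (cnj z))"
        by (subst sums_cnj)
      then show ?case by (simp add: ma_minda_cnj[OF assms elim])
    qed
  qed
  from fps_expansion_unique_complex[OF this has_fps_expansion_disc[OF hol]]
  have "cnj (fps_nth ?P n) = fps_nth ?P n"
    by (metis fps_nth_Abs_fps)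
  then show ?thesis by (simp add: Reals_cnj_iff)
qed

section \<open>Univalence of convex functions\<close>

text \<open>Restriction to a line yields functions of one real variable, for which a negative
  derivative at 0 means strict decrease to the right.\<close>

lemma has_real_derivative_along_line:
  fixes g :: "complex \<Rightarrow> complex"
  assumes "(g has_field_derivative g') (at z)"
  shows "((\<lambda>s::real. Re (g (z + s * v))) has_real_derivative Re (g' * v)) (at 0)"
    and "((\<lambda>s::real. Im (g (z + s * v))) has_real_derivative Im (g' * v)) (at 0)"
proof -
  have "((\<lambda>s. g (z + s * v)) has_field_derivative g' * v) (at 0)"
    using assms by (intro DERIV_chain2[where f = g]) (auto intro!: derivative_eq_intros)
  then have "((\<lambda>s::real. g (z + s * v)) has_vector_derivative g' * v) (at 0)"
    using has_vector_derivative_real_field[of "\<lambda>s. g (z + s * v)" "g' * v" 0] by simp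
  note has_field_derivative_Re[OF this] has_field_derivative_Im[OF this]
  then show "((\<lambda>s::real. Re (g (z + s * v))) has_real_derivative Re (g' * v)) (at 0)"
    and "((\<lambda>s::real. Im (g (z + s * v))) has_real_derivative Im (g' * v)) (at 0)"
    by - assumption+
qed

text \<open>The derivative of |g|^2 in the direction \<open>v\<close> is twice the real part in the
  second assumption.\<close>

lemma cmod_less_along_line:
  fixes g :: "complex \<Rightarrow> complex"
  assumes "(g has_field_derivative g') (at z)" "Re (cnj (g z) * (g' * v)) < 0"
  shows "\<exists>d>0. \<forall>s>0. s < d \<longrightarrow> cmod (g (z + of_real s * v)) < cmod (g z)"
proof -
  have "((\<lambda>s::real. (Re (g (z + s * v)))\<^sup>2 + (Im (g (z + s * v)))\<^sup>2)
      has_real_derivative 2 * Re (cnj (g z) * (g' * v))) (at 0)"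
    by (rule derivative_eq_intros has_real_derivative_along_line[OF assms(1)] refl | simp)+
  from DERIV_neg_dec_right[OF this] assms(2)
  obtain d where "d > 0" "\<And>s. 0 < s \<Longrightarrow> s < d \<Longrightarrow> (cmod (g (z + of_real s * v)))\<^sup>2 < (cmod (g z))\<^sup>2"
    by (auto simp: cmod_power2)
  then show ?thesis
    by (metis norm_ge_zero power2_less_imp_less)
qed

text \<open>
  At a zero \<open>z\<close> of \<open>Re g\<close> of least modulus, \<open>Re g\<close> cannot decrease in any inward direction, so
  \<open>z * deriv g z\<close> is real and nonpositive; by the differential equation this forces \<open>Re (P z) = 0\<close>.
\<close>
lemma Re_pos_if_Briot_Bouquet:
  fixes g P :: "complex \<Rightarrow> complex"
  assumes g: "g holomorphic_on \<D>" "g 0 = 1"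
    and P: "\<And>z. z \<in> \<D> \<Longrightarrow> 0 < Re (P z)"
    and eq: "\<And>z. z \<in> \<D> \<Longrightarrow> P z * g z + z * deriv g z = 1"
    and z: "z \<in> \<D>"
  shows "0 < Re (g z)"
proof (rule ccontr)
  assume neg: "\<not> 0 < Re (g z)"
  define K where "K = {w \<in> cball 0 (cmod z). Re (g w) \<le> 0}"
  have sub: "cball 0 (cmod z) \<subseteq> \<D>" using z by auto
  have cont: "continuous_on \<D> g" using g(1) by (rule holomorphic_on_imp_continuous_on)
  have "K = cball 0 (cmod z) \<inter> g -` {w. Re w \<le> 0}" by (auto simp: K_def)
  then have "closed K"
    using continuous_closed_preimage[OF continuous_on_subset[OF cont sub] closed_cball closed_halfspace_Re_le]
    by simp
  moreover have "bounded K" by (rule bounded_subset[OF bounded_cball[of 0 "cmod z"]]) (auto simp: K_def)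
  ultimately have "compact K" by (simp add: compact_eq_bounded_closed)
  moreover have "z \<in> K" using neg by (simp add: K_def)
  ultimately obtain z0 where z0: "z0 \<in> K" and min: "\<And>w. w \<in> K \<Longrightarrow> cmod z0 \<le> cmod w"
    using continuous_attains_inf[of K cmod] continuous_on_norm_id by blast
  have pos: "0 < Re (g w)" if "cmod w < cmod z0" for w
    using min[of w] that z0 by (force simp: K_def)
  have z0D: "z0 \<in> \<D>" using z0 sub by (auto simp: K_def)
  have "z0 \<noteq> 0" using z0 g by (auto simp: K_def)
  \<comment> \<open>On the open radius from 0 to \<open>z0\<close> the real part of g is positive,
    so in the limit \<open>Re (g z0)\<close> is nonnegative; as \<open>z0\<close> lies in
    \<open>K\<close>, it is 0.\<close>
  have "isCont g z0"
    using cont z0D by (simp add: continuous_on_eq_continuous_at)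
  moreover have "((\<lambda>t::real. t * z0) \<longlongrightarrow> of_real 1 * z0) (at_left 1)"
    by (intro tendsto_intros)
  ultimately have "((\<lambda>t::real. Re (g (t * z0))) \<longlongrightarrow> Re (g z0)) (at_left 1)"
    by (intro tendsto_Re isCont_tendsto_compose[of _ g]) auto
  moreover have "eventually (\<lambda>t::real. 0 \<le> Re (g (t * z0))) (at_left 1)"
    using eventually_at_left_real[OF zero_less_one]
    by eventually_elim (use \<open>z0 \<noteq> 0\<close> in \<open>auto intro!: less_imp_le[OF pos] simp: norm_mult\<close>)
  ultimately have "0 \<le> Re (g z0)"
    by (auto intro: tendsto_lowerbound)
  with z0 have Re0: "Re (g z0) = 0" by (auto simp: K_def)
  define c where "c = z0 * deriv g z0"
  have dg: "(g has_field_derivative deriv g z0) (at z0)"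
    using holomorphic_derivI[OF g(1) _ z0D] by simp
  \<comment> \<open>For \<open>Re u < 0\<close> the direction \<open>z0 * u\<close> points inward:
    |w|^2 changes at the rate 2 |z0|^2 \<open>Re u\<close>.\<close>
  have inward: "0 \<le> Re (c * u)" if "Re u < 0" for u
  proof (rule ccontr)
    assume "\<not> 0 \<le> Re (c * u)"
    then have "Re (deriv g z0 * (z0 * u)) < 0" by (simp add: c_def mult_ac)
    from DERIV_neg_dec_right[OF has_real_derivative_along_line(1)[OF dg] this]
    obtain d1 where d1: "d1 > 0" "\<And>s. 0 < s \<Longrightarrow> s < d1 \<Longrightarrow> Re (g (z0 + of_real s * (z0 * u))) < 0"
      by (auto simp: Re0)
    have "Re (cnj z0 * (1 * (z0 * u))) = (cmod z0)\<^sup>2 * Re u"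
      unfolding cmod_power2 by (simp add: power2_eq_square algebra_simps)
    also have "\<dots> < 0" using that \<open>z0 \<noteq> 0\<close> by (simp add: mult_pos_neg)
    finally have "\<exists>d>0. \<forall>s>0. s < d \<longrightarrow> cmod (z0 + of_real s * (z0 * u)) < cmod z0"
      by (intro cmod_less_along_line[OF DERIV_ident])
    then obtain d2 where d2: "d2 > 0" "\<And>s. 0 < s \<Longrightarrow> s < d2 \<Longrightarrow> cmod (z0 + of_real s * (z0 * u)) < cmod z0"
      by auto
    define s where "s = min d1 d2 / 2"
    have "0 < s" "s < d1" "s < d2" using d1(1) d2(1) by (auto simp: s_def)
    with d1(2) pos[OF d2(2)] show False by force
  qed
  define y where "y = Im (g z0)"
  have gy: "g z0 = \<i> * y" using Re0 by (simp add: y_def complex_eq_iff)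
  have c: "c = 1 - P z0 * (\<i> * y)"
    using eq[OF z0D] by (simp add: c_def gy algebra_simps)
  show False
  proof (cases "y = 0")
    case True
    then show False using inward[of "-1"] c by simp
  next
    case False
    then have "Im c \<noteq> 0" using P[OF z0D] by (simp add: c)
    \<comment> \<open>The imaginary part of this \<open>u\<close> is chosen to give
      \<open>Re (c * u) = - 1\<close>.\<close>
    then show False using inward[of "Complex (-1) ((1 - Re c) / Im c)"] by simp
  qed
qed

text \<open>The segment from f(z) towards 0 is lifted by a local inverse of f. The lift starts with
  velocity - z q, and Re q > 0 makes its modulus decrease. The radius \<open>e\<close> serves to
  keep lifts from two distinct points apart.\<close>

lemma starlike_flow_step:
  assumes f: "f holomorphic_on \<D>" and z: "z \<in> \<D>" "z \<noteq> 0" and nz: "deriv f z \<noteq> 0"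
    and fz: "f z = z * deriv f z * q" "0 < Re q" and "0 < e"
  shows "\<exists>d>0. \<forall>t>0. t < d \<longrightarrow> (\<exists>w \<in> \<D> \<inter> ball z e. f w = (1 - of_real t) * f z \<and> cmod w < cmod z)"
proof -
  have "f holomorphic_on (\<D> \<inter> ball z e)" using f holomorphic_on_subset by blast
  from has_complex_derivative_locally_invertible[OF this, of z] z nz \<open>0 < e\<close>
  obtain r where r: "0 < r" "ball z r \<subseteq> \<D> \<inter> ball z e" "open (f ` ball z r)" "inj_on f (ball z r)"
    by auto
  have "f holomorphic_on ball z r" using f r(2) holomorphic_on_subset by blast
  from holomorphic_has_inverse[OF this open_ball r(4)]
  obtain h where h: "h holomorphic_on f ` ball z r" "\<And>w. w \<in> ball z r \<Longrightarrow> deriv f w * deriv h (f w) = 1"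
    "\<And>w. w \<in> ball z r \<Longrightarrow> h (f w) = w" by blast
  have zr: "z \<in> ball z r" using r by simp
  have dh: "(h has_field_derivative deriv h (f z)) (at (f z))"
    using holomorphic_derivI[OF h(1) r(3)] zr by blast
  have "deriv h (f z) * (- f z) = - (z * q)"
    using h(2)[OF zr] fz(1) by algebra
  then have "Re (cnj (h (f z)) * (deriv h (f z) * (- f z))) = - ((cmod z)\<^sup>2 * Re q)"
    unfolding cmod_power2 by (simp add: h(3)[OF zr] power2_eq_square algebra_simps)
  also have "\<dots> < 0" using fz(2) z by simp
  finally obtain d1 where d1: "d1 > 0"
    "\<And>t. 0 < t \<Longrightarrow> t < d1 \<Longrightarrow> cmod (h (f z + of_real t * (- f z))) < cmod z"
    using cmod_less_along_line[OF dh, of "- f z"] by (auto simp: h(3)[OF zr])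
  have "((\<lambda>t::real. f z + t * (- f z)) \<longlongrightarrow> f z + of_real 0 * (- f z)) (at_right 0)"
    by (intro tendsto_intros)
  then have "eventually (\<lambda>t::real. f z + t * (- f z) \<in> f ` ball z r) (at_right 0)"
    by (rule topological_tendstoD) (use r zr in auto)
  then obtain d2 :: real where d2: "d2 > 0"
    "\<And>t. 0 < t \<Longrightarrow> t < d2 \<Longrightarrow> f z + t * (- f z) \<in> f ` ball z r"
    unfolding eventually_at_right_field by auto
  show ?thesis
  proof (intro exI[of _ "min d1 d2"] conjI allI impI)
    fix t :: real assume t: "0 < t" "t < min d1 d2"
    then obtain w where w: "w \<in> ball z r" "f z + t * (- f z) = f w"
      using d2(2)[of t] by auto
    then have "cmod w < cmod z" using d1(2)[of t] t h(3) by simp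
    with w r(2) show "\<exists>w \<in> \<D> \<inter> ball z e. f w = (1 - of_real t) * f z \<and> cmod w < cmod z"
      by (intro bexI[of _ w]) (auto simp: algebra_simps)
  qed (use d1 d2 in auto)
qed

text \<open>
  Shrinking the common value of a collision \<open>f z = f w\<close> towards \<open>0\<close> decreases both moduli, so no
  collision minimises \<open>\<bar>z\<bar> + \<bar>w\<bar>\<close>; local injectivity makes the set of collisions closed.
\<close>
lemma starlike_imp_inj_on:
  assumes f: "f holomorphic_on \<D>" and nz: "\<And>z. z \<in> \<D> \<Longrightarrow> deriv f z \<noteq> 0"
    and eq: "\<And>z. z \<in> \<D> \<Longrightarrow> f z = z * deriv f z * q z" and q: "\<And>z. z \<in> \<D> \<Longrightarrow> 0 < Re (q z)"
  shows "inj_on f \<D>"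
proof (rule ccontr)
  assume "\<not> inj_on f \<D>"
  then obtain a b where ab: "a \<in> \<D>" "b \<in> \<D>" "a \<noteq> b" "f a = f b" by (auto simp: inj_on_def)
  define \<rho> where "\<rho> = max (cmod a) (cmod b)"
  have sub: "cball 0 \<rho> \<subseteq> \<D>" using ab by (auto simp: \<rho>_def)
  define S where "S = {(z, w) \<in> cball 0 \<rho> \<times> cball 0 \<rho>. z \<noteq> w \<and> f z = f w}"
  have "closed S"
    unfolding closed_sequential_limits
  proof safe
    fix p z w assume p: "\<forall>n. p n \<in> S" "p \<longlonglongrightarrow> (z, w)"
    have lim: "(\<lambda>n. fst (p n)) \<longlonglongrightarrow> z" "(\<lambda>n. snd (p n)) \<longlonglongrightarrow> w"
      using tendsto_fst[OF p(2)] tendsto_snd[OF p(2)] by simp_all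
    have pn: "fst (p n) \<in> cball 0 \<rho>" "snd (p n) \<in> cball 0 \<rho>" "fst (p n) \<noteq> snd (p n)"
      "f (fst (p n)) = f (snd (p n))" for n
      using p(1) by (auto simp: S_def case_prod_unfold)
    have zw: "z \<in> cball 0 \<rho>" "w \<in> cball 0 \<rho>"
      using closed_sequentially[OF closed_cball _ lim(1)] closed_sequentially[OF closed_cball _ lim(2)] pn by blast+
    have cont: "isCont f u" if "u \<in> cball 0 \<rho>" for u
      using that sub f holomorphic_on_imp_continuous_on continuous_on_eq_continuous_at open_ball by blast
    have "f z = f w"
      using LIMSEQ_unique[OF isCont_tendsto_compose[OF cont[OF zw(1)] lim(1)]]
        isCont_tendsto_compose[OF cont[OF zw(2)] lim(2)] pn(4) by simp
    moreover have "z \<noteq> w"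
    proof
      assume "z = w"
      obtain r where r: "r > 0" "ball z r \<subseteq> \<D>" "inj_on f (ball z r)"
        using has_complex_derivative_locally_injective[OF f _ _ nz, of z] zw sub by blast
      have "eventually (\<lambda>n. fst (p n) \<in> ball z r) sequentially"
        by (rule topological_tendstoD[OF lim(1)]) (use r in auto)
      moreover have "eventually (\<lambda>n. snd (p n) \<in> ball z r) sequentially"
        by (rule topological_tendstoD[OF lim(2)]) (use r \<open>z = w\<close> in auto)
      ultimately have "eventually (\<lambda>n. False) sequentially"
        by eventually_elim (use inj_onD[OF r(3) pn(4)] pn(3) in blast)
      then show False by simp
    qed
    ultimately show "(z, w) \<in> S" using zw by (simp add: S_def)
  qed
  moreover have "bounded S"
    by (rule bounded_subset[of "cball 0 \<rho> \<times> cball 0 \<rho>"]) (auto simp: S_def bounded_Times)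
  ultimately have "compact S" by (simp add: compact_eq_bounded_closed)
  moreover have "(a, b) \<in> S" using ab by (auto simp: S_def \<rho>_def)
  moreover have "continuous_on S (\<lambda>p. cmod (fst p) + cmod (snd p))"
    by (intro continuous_intros)
  ultimately obtain p where p: "p \<in> S"
    "\<And>p'. p' \<in> S \<Longrightarrow> cmod (fst p) + cmod (snd p) \<le> cmod (fst p') + cmod (snd p')"
    using continuous_attains_inf[of S] by blast
  obtain z w where zw: "p = (z, w)" by (cases p)
  have zD: "z \<in> \<D>" "w \<in> \<D>" "z \<noteq> w" "f z = f w" and "cmod z \<le> \<rho>" "cmod w \<le> \<rho>"
    using p(1) sub by (auto simp: S_def zw)
  \<comment> \<open>By \<open>eq\<close>, the only zero of f is 0, so two distinct points cannot
    collide at the value 0.\<close>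
  have "f z \<noteq> 0"
  proof
    assume "f z = 0"
    moreover have "u = 0" if "u \<in> \<D>" "f u = 0" for u
      using eq[OF that(1)] nz[OF that(1)] q[OF that(1)] that(2) by auto
    ultimately show False using zD by metis
  qed
  then have "z \<noteq> 0" "w \<noteq> 0" using eq[OF zD(1)] eq[OF zD(2)] zD(4) by auto
  \<comment> \<open>Half the distance makes the two balls disjoint, so the moved points stay
    distinct.\<close>
  define e where "e = dist z w / 2"
  have "e > 0" using zD by (simp add: e_def)
  obtain d1 where d1: "d1 > 0"
    "\<And>t::real. 0 < t \<Longrightarrow> t < d1 \<Longrightarrow> \<exists>u \<in> \<D> \<inter> ball z e. f u = (1 - of_real t) * f z \<and> cmod u < cmod z"
    using starlike_flow_step[OF f zD(1) \<open>z \<noteq> 0\<close> nz[OF zD(1)] eq[OF zD(1)] q[OF zD(1)] \<open>e > 0\<close>]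
    by blast
  obtain d2 where d2: "d2 > 0"
    "\<And>t::real. 0 < t \<Longrightarrow> t < d2 \<Longrightarrow> \<exists>u \<in> \<D> \<inter> ball w e. f u = (1 - of_real t) * f w \<and> cmod u < cmod w"
    using starlike_flow_step[OF f zD(2) \<open>w \<noteq> 0\<close> nz[OF zD(2)] eq[OF zD(2)] q[OF zD(2)] \<open>e > 0\<close>]
    by blast
  \<comment> \<open>One \<open>t\<close> serves both points, so that their new values still
    agree.\<close>
  define t where "t = min d1 d2 / 2"
  have t: "0 < t" "t < d1" "t < d2" using d1(1) d2(1) by (auto simp: t_def)
  obtain z' where z': "z' \<in> ball z e" "f z' = (1 - of_real t) * f z" "cmod z' < cmod z"
    using d1(2)[OF t(1,2)] by blast
  obtain w' where w': "w' \<in> ball w e" "f w' = (1 - of_real t) * f w" "cmod w' < cmod w"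
    using d2(2)[OF t(1,3)] by blast
  have "z' \<noteq> w'"
    using z'(1) w'(1) dist_triangle_half_l[of z' z "2 * e" w] unfolding e_def
    by (metis (no_types) dist_commute dist_triangle_half_r less_irrefl mem_ball)
  then have "(z', w') \<in> S"
    using z' w' zD \<open>cmod z \<le> \<rho>\<close> \<open>cmod w \<le> \<rho>\<close> by (simp add: S_def)
  from p(2)[OF this] z'(3) w'(3) show False by (simp add: zw)
qed

text \<open>The quotient g = f / (z f') satisfies P g + z g' = 1 with P = 1 + z f''/f'. Hence Re g >
  0, so f is starlike and therefore univalent. The reciprocal of z f'/f is used because f' is known
  to have no zeros, whereas f away from 0 is not yet.\<close>

lemma class_S_if_Re_pos:
  assumes f: "f holomorphic_on \<D>" "f 0 = 0" "deriv f 0 = 1"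
    and nz: "\<And>z. z \<in> \<D> \<Longrightarrow> deriv f z \<noteq> 0"
    and Re: "\<And>z. z \<in> \<D> \<Longrightarrow> 0 < Re (1 + z * deriv (deriv f) z / deriv f z)"
  shows "f \<in> class_S"
proof -
  obtain h where h: "h holomorphic_on \<D>" "\<And>z. cmod z < 1 \<Longrightarrow> f z = z * h z" "deriv f 0 = h 0"
    using Schwarz3[OF f(1,2)] by blast
  have hf': "deriv f holomorphic_on \<D>"
    using f(1) by (intro holomorphic_deriv) auto
  define g where "g z = h z / deriv f z" for z
  have g: "g holomorphic_on \<D>"
    unfolding g_def by (intro holomorphic_intros h hf' nz)
  have ode: "(1 + z * deriv (deriv f) z / deriv f z) * g z + z * deriv g z = 1" if z: "z \<in> \<D>" for z
  proof -
    have dh: "(h has_field_derivative deriv h z) (at z)"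
      using holomorphic_derivI[OF h(1) _ z] by simp
    have df: "(deriv f has_field_derivative deriv (deriv f) z) (at z)"
      using holomorphic_derivI[OF hf' _ z] by simp
    have "((\<lambda>z. z * h z) has_field_derivative h z + z * deriv h z) (at z)"
      using dh by (auto intro!: derivative_eq_intros)
    then have "(f has_field_derivative h z + z * deriv h z) (at z)"
      by (rule has_field_derivative_transform_within_open[of _ _ _ \<D>]) (use z h(2) in auto)
    then have f': "deriv f z = h z + z * deriv h z" by (rule DERIV_imp_deriv)
    have "(g has_field_derivative (deriv h z * deriv f z - h z * deriv (deriv f) z) / (deriv f z * deriv f z)) (at z)"
      unfolding g_def using DERIV_divide[OF dh df nz[OF z]] .
    then have g': "deriv g z = (deriv h z * deriv f z - h z * deriv (deriv f) z) / (deriv f z * deriv f z)"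
      by (rule DERIV_imp_deriv)
    have "(1 + z * deriv (deriv f) z / deriv f z) * g z + z * deriv g z = (h z + z * deriv h z) / deriv f z"
      using nz[OF z] unfolding g' g_def by (simp add: divide_simps) algebra
    also have "\<dots> = 1" using nz[OF z] f' by simp
    finally show ?thesis .
  qed
  have "g 0 = 1" using f h by (simp add: g_def)
  from Re_pos_if_Briot_Bouquet[OF g this Re ode]
  have "inj_on f \<D>"
    using nz h(2) by (intro starlike_imp_inj_on[OF f(1) nz, of g]) (auto simp: g_def)
  with f show ?thesis by (simp add: class_S_def)
qed

text \<open>The equation is integrated twice: f''/f' = (\<phi> o \<omega> - 1)/z has a removable
  singularity, f' is the exponential of a primitive, hence free of zeros, and f is a primitive of
  that. Primitives vanishing at 0 provide f(0) = 0 and f'(0) = 1.\<close>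

lemma class_C_realizes_schwarz_function:
  assumes \<phi>: "\<phi> holomorphic_on \<D>" "\<phi> 0 = 1" "\<forall>z\<in>\<D>. 0 < Re (\<phi> z)"
    and \<omega>: "schwarz_function \<omega>"
  obtains f where "f \<in> class_C \<phi>" "\<forall>z\<in>\<D>. 1 + z * deriv (deriv f) z / deriv f z = \<phi> (\<omega> z)"
proof -
  have \<omega>': "\<omega> holomorphic_on \<D>" "\<omega> ` \<D> \<subseteq> \<D>" "\<omega> 0 = 0"
    using \<omega> by (auto simp: schwarz_function_def)
  have "\<phi> \<circ> \<omega> holomorphic_on \<D>"
    by (rule holomorphic_on_compose_gen[OF \<omega>'(1) \<phi>(1) \<omega>'(2)])
  then have "(\<lambda>z. \<phi> (\<omega> z) - 1) holomorphic_on \<D>"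
    by (intro holomorphic_intros) (simp add: o_def)
  then obtain h where h: "h holomorphic_on \<D>" "\<And>z. cmod z < 1 \<Longrightarrow> \<phi> (\<omega> z) - 1 = z * h z"
    using Schwarz3[of "\<lambda>z. \<phi> (\<omega> z) - 1" 1] \<omega>'(3) \<phi>(2) by auto
  have prim: "\<exists>G. G 0 = 0 \<and> (\<forall>z\<in>\<D>. (G has_field_derivative g z) (at z))"
    if g: "g holomorphic_on \<D>" for g
  proof -
    obtain G where G: "\<And>z. z \<in> \<D> \<Longrightarrow> (G has_field_derivative g z) (at z within \<D>)"
      using holomorphic_convex_primitive'[OF convex_ball open_ball g] by blast
    have "((\<lambda>z. G z - G 0) has_field_derivative g z) (at z)" if "z \<in> \<D>" for z
      using G[OF that] that by (auto simp: at_within_open[OF that] intro!: derivative_eq_intros)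
    then show ?thesis by (intro exI[of _ "\<lambda>z. G z - G 0"]) simp
  qed
  obtain Q where Q: "Q 0 = 0" "\<And>z. z \<in> \<D> \<Longrightarrow> (Q has_field_derivative h z) (at z)"
    using prim[OF h(1)] by blast
  have Qe: "((\<lambda>z. exp (Q z)) has_field_derivative exp (Q z) * h z) (at z)" if "z \<in> \<D>" for z
    using Q(2)[OF that] by (auto intro!: derivative_eq_intros)
  then have "(\<lambda>z. exp (Q z)) holomorphic_on \<D>"
    by (meson field_differentiable_def has_field_derivative_at_within holomorphic_onI)
  from prim[OF this] obtain f
    where f: "f 0 = 0" "\<And>z. z \<in> \<D> \<Longrightarrow> (f has_field_derivative exp (Q z)) (at z)"
    by blast
  have f': "deriv f z = exp (Q z)" if "z \<in> \<D>" for z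
    using f(2)[OF that] by (rule DERIV_imp_deriv)
  have "(deriv f has_field_derivative exp (Q z) * h z) (at z)" if "z \<in> \<D>" for z
    by (rule has_field_derivative_transform_within_open[OF Qe[OF that], of \<D>]) (use that f' in auto)
  then have f'': "deriv (deriv f) z = exp (Q z) * h z" if "z \<in> \<D>" for z
    using DERIV_imp_deriv that by blast
  have eq: "1 + z * deriv (deriv f) z / deriv f z = \<phi> (\<omega> z)" if z: "z \<in> \<D>" for z
    using h(2)[of z] z by (simp add: f'[OF z] f''[OF z] algebra_simps)
  have "f holomorphic_on \<D>"
    using f(2) by (meson field_differentiable_def has_field_derivative_at_within holomorphic_onI)
  moreover have "deriv f 0 = 1" by (simp add: f' Q)
  ultimately have "f \<in> class_S"
    using f(1) f' eq \<phi>(3) \<omega>'(2) by (intro class_S_if_Re_pos) (auto simp: image_subset_iff)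
  then have "f \<in> class_C \<phi>"
    using eq \<omega> by (auto simp: class_C_def subordinate_def)
  with eq show ?thesis by (intro that ballI)
qed

section \<open>Sharp bound\<close>

theorem theorem2p4:
  fixes \<phi> :: "complex \<Rightarrow> complex" and B :: "nat \<Rightarrow> real" and \<mu>\<^sub>2 \<nu>\<^sub>2 :: real
  assumes "ma_minda \<phi>"
    and "\<And>n. B n = Re (fps_nth (fps_expansion \<phi> 0) n)"
    and "\<mu>\<^sub>2 = ((B 1)\<^sup>2 + 4 * B 2) / (2 * B 1)"
    and "\<nu>\<^sub>2 = (B 1 * B 2 + 2 * B 3) / (2 * B 1)"
  shows "(\<forall>n. fps_nth (fps_expansion \<phi> 0) n = complex_of_real (B n)) \<and> 0 < B 1 \<and>
    (\<bar>B 2 + 1 / 4 * (B 1)\<^sup>2\<bar> \<ge> B 1 \<and> (\<mu>\<^sub>2, \<nu>\<^sub>2) \<in> D1 \<union> D2 \<union> D3 \<longrightarrow>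
      (\<forall>f \<gamma>. f \<in> class_C \<phi> \<and> log_coeffs f \<gamma> \<longrightarrow>
        cmod ((\<gamma> 2)\<^sup>2 - (\<gamma> 3)\<^sup>2) \<le>
          (B 1 ^ 4 + 8 * (B 1)\<^sup>2 * B 2 + 16 * (B 2)\<^sup>2 + (B 1)\<^sup>2 * (B 2)\<^sup>2
             + 4 * B 1 * B 2 * B 3 + 4 * (B 3)\<^sup>2) / 2304) \<and>
      (\<exists>f \<gamma>. f \<in> class_C \<phi> \<and> log_coeffs f \<gamma> \<and>
        cmod ((\<gamma> 2)\<^sup>2 - (\<gamma> 3)\<^sup>2) =
          (B 1 ^ 4 + 8 * (B 1)\<^sup>2 * B 2 + 16 * (B 2)\<^sup>2 + (B 1)\<^sup>2 * (B 2)\<^sup>2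
             + 4 * B 1 * B 2 * B 3 + 4 * (B 3)\<^sup>2) / 2304))"
  (is "?real \<and> ?pos \<and> (?cond \<longrightarrow> ?upper \<and> ?sharp)")
proof (intro conjI impI)
  let ?P = "fps_nth (fps_expansion \<phi> 0)"
  have \<phi>: "\<phi> holomorphic_on \<D>" "\<phi> 0 = 1" and Re\<phi>: "\<forall>z\<in>\<D>. 0 < Re (\<phi> z)"
    and d\<phi>: "0 < Re (deriv \<phi> 0)"
    using assms(1) by (auto simp: ma_minda_def)
  have P: "?P n = of_real (B n)" for n
    using ma_minda_coeffs_real[OF assms(1), of n] by (simp add: assms(2) complex_is_Real_iff complex_eq_iff)
  then show ?real by blast
  show pos: ?pos
    using d\<phi> by (simp add: assms(2) fps_expansion_def)
  \<comment> \<open>Up to unimodular factors, \<open>K\<close> and \<open>N\<close> are the values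
    of 48 \<gamma>_2 and 48 \<gamma>_3 when \<omega> is a rotation; the claimed bound is (K^2 + N^2)
    / 48^2.\<close>
  define K N where "K = 4 * B 2 + (B 1)\<^sup>2" and "N = 2 * B 3 + B 1 * B 2"
  have bound: "(B 1 ^ 4 + 8 * (B 1)\<^sup>2 * B 2 + 16 * (B 2)\<^sup>2 + (B 1)\<^sup>2 * (B 2)\<^sup>2
             + 4 * B 1 * B 2 * B 3 + 4 * (B 3)\<^sup>2) / 2304 = (K / 48)\<^sup>2 + (N / 48)\<^sup>2"
    unfolding K_def N_def by (simp add: field_simps power2_eq_square power4_eq_xxxx)
  have KN: "K = 2 * B 1 * \<mu>\<^sub>2" "N = 2 * B 1 * \<nu>\<^sub>2"
    unfolding assms(3,4) K_def N_def using pos by (simp_all add: field_simps)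
  have coeffs: "\<gamma> 2 = (4 * B 1 * c 2 + K * (c 1)\<^sup>2) / 48"
      "\<gamma> 3 = (2 * B 1 * c 3 + K * c 1 * c 2 + N * c 1 ^ 3) / 48"
    if "f \<in> class_C \<phi>" "log_coeffs f \<gamma>" "schwarz_function \<omega>"
      "\<forall>z\<in>\<D>. 1 + z * deriv (deriv f) z / deriv f z = \<phi> (\<omega> z)"
      "c = fps_nth (fps_expansion \<omega> 0)" for f \<omega> and \<gamma> c :: "nat \<Rightarrow> complex"
    using log_coeffs_2_3[OF _ \<phi> that(3) bspec[OF that(4)] that(2)] that(1) unfolding class_C_def P K_def N_def that(5)
    by simp_all
  {
    assume ?cond
    then have K: "4 * B 1 \<le> \<bar>K\<bar>" and D: "(\<mu>\<^sub>2, \<nu>\<^sub>2) \<in> D1 \<union> D2 \<union> D3"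
      by (auto simp: K_def)
    show ?upper
    proof (intro allI impI)
      fix f \<gamma> assume f: "f \<in> class_C \<phi> \<and> log_coeffs f \<gamma>"
      then obtain \<omega> where \<omega>: "schwarz_function \<omega>"
          "\<forall>z\<in>\<D>. 1 + z * deriv (deriv f) z / deriv f z = \<phi> (\<omega> z)"
        by (auto simp: class_C_def subordinate_def)
      define c where "c = fps_nth (fps_expansion \<omega> 0)"
      define s where "s = 1 - (cmod (c 1))\<^sup>2"
      obtain x y :: complex where xy: "cmod (c 1) \<le> 1" "cmod x \<le> 1" "cmod y \<le> 1" "c 2 = s * x"
          "c 3 = s * ((1 - (cmod x)\<^sup>2) * y - cnj (c 1) * x\<^sup>2)"
        using schwarz_function_coeffs[OF \<omega>(1)] unfolding c_def s_def by blast
      have s: "0 \<le> s" using xy(1) by (simp add: s_def power_le_one)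
      note \<gamma> = coeffs[OF conjunct1[OF f] conjunct2[OF f] \<omega> c_def]
      have "cmod (4 * B 1 * c 2 + K * (c 1)\<^sup>2) \<le> 4 * B 1 * (s * cmod x) + \<bar>K\<bar> * (cmod (c 1))\<^sup>2"
        using norm_triangle_ineq[of "4 * B 1 * c 2" "K * (c 1)\<^sup>2"] pos s
        by (simp add: norm_mult norm_power xy(4))
      \<comment> \<open>Since 4 B_1 \<le> |K|, both terms can carry the factor |K|, and their
        weights \<open>s\<close> and |c_1|^2 add up to 1.\<close>
      also have "\<dots> \<le> \<bar>K\<bar> * (s * 1) + \<bar>K\<bar> * (cmod (c 1))\<^sup>2"
        using pos s xy(2) K by (intro add_right_mono mult_mono) auto
      also have "\<dots> = \<bar>K\<bar>"
        by (simp add: s_def algebra_simps)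
      finally have "cmod (\<gamma> 2) \<le> \<bar>K\<bar> / 48"
        by (simp add: \<gamma>(1) norm_divide)
      then have g2: "(cmod (\<gamma> 2))\<^sup>2 \<le> (\<bar>K\<bar> / 48)\<^sup>2"
        by (intro power_mono) auto
      \<comment> \<open>Extracting 2 B_1 leaves the functional of Prokhorov and Szynal at
        \<open>(\<mu>\<^sub>2, \<nu>\<^sub>2)\<close>.\<close>
      have "2 * B 1 * c 3 + K * c 1 * c 2 + N * c 1 ^ 3
          = (2 * B 1) * (c 3 + \<mu>\<^sub>2 * c 1 * (s * x) + \<nu>\<^sub>2 * c 1 ^ 3)"
        unfolding KN xy(4) by (simp add: algebra_simps)
      then have "cmod (2 * B 1 * c 3 + K * c 1 * c 2 + N * c 1 ^ 3)
          = 2 * B 1 * cmod (c 3 + \<mu>\<^sub>2 * c 1 * (s * x) + \<nu>\<^sub>2 * c 1 ^ 3)"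
        using pos by (simp add: norm_mult)
      also have "\<dots> \<le> 2 * B 1 * \<nu>\<^sub>2"
        unfolding xy(5) s_def using pos prokhorov_szynal[OF D xy(1-3)] by (intro mult_left_mono) auto
      also have "2 * B 1 * \<nu>\<^sub>2 = N"
        by (simp add: KN)
      finally have "cmod (\<gamma> 3) \<le> N / 48"
        by (simp add: \<gamma>(2) norm_divide)
      then have g3: "(cmod (\<gamma> 3))\<^sup>2 \<le> (N / 48)\<^sup>2"
        by (intro power_mono) auto
      show "cmod ((\<gamma> 2)\<^sup>2 - (\<gamma> 3)\<^sup>2) \<le>
          (B 1 ^ 4 + 8 * (B 1)\<^sup>2 * B 2 + 16 * (B 2)\<^sup>2 + (B 1)\<^sup>2 * (B 2)\<^sup>2
             + 4 * B 1 * B 2 * B 3 + 4 * (B 3)\<^sup>2) / 2304"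
        unfolding bound using g2 g3 norm_triangle_ineq4[of "(\<gamma> 2)\<^sup>2" "(\<gamma> 3)\<^sup>2"]
        by (simp add: norm_power power_divide)
    qed
  next
    \<comment> \<open>Here c_1 = \<open>\<i>\<close> and all other coefficients vanish, so
      \<gamma>_2 is real and \<gamma>_3 imaginary: subtracting \<gamma>_3^2 adds N^2 / 48^2. The
      identity as \<omega> would give the difference K^2 - N^2 instead.\<close>
    have \<omega>: "schwarz_function (\<lambda>z. \<i> * z)"
      by (auto simp: schwarz_function_def norm_mult intro!: holomorphic_intros)
    obtain f where f: "f \<in> class_C \<phi>"
        "\<forall>z\<in>\<D>. 1 + z * deriv (deriv f) z / deriv f z = \<phi> (\<i> * z)"
      using class_C_realizes_schwarz_function[OF \<phi> Re\<phi> \<omega>] by blast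
    then obtain \<gamma> where \<gamma>: "log_coeffs f \<gamma>"
      using log_coeffs_exist unfolding class_C_def by blast
    have "fps_expansion (\<lambda>z. \<i> * z) 0 = fps_const \<i> * fps_X"
      by (intro fps_expansion_eqI fps_expansion_intros)
    then have g: "\<gamma> 2 = - of_real (K / 48)" "\<gamma> 3 = - \<i> * of_real (N / 48)"
      using coeffs[OF f(1) \<gamma> \<omega> f(2) refl] by (simp_all add: power3_eq_cube)
    have "(\<gamma> 2)\<^sup>2 - (\<gamma> 3)\<^sup>2 = of_real ((K / 48)\<^sup>2 + (N / 48)\<^sup>2)"
      unfolding g by (simp add: power_divide power_mult_distrib)
    then have "cmod ((\<gamma> 2)\<^sup>2 - (\<gamma> 3)\<^sup>2) = (K / 48)\<^sup>2 + (N / 48)\<^sup>2"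
      by (simp only: norm_of_real) simp
    with f(1) \<gamma> show ?sharp unfolding bound by blast
  }
qed

end
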